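(* Let $X=(\mathbb{R}^n,\|\cdot\|)$ be an $n$-dimensional permutation-invariant normed space. Then $e(X)\geq n+1$.
   Context: For a real finite-dimensional normed space $X$ with norm $\|\cdot\|$, a set $S\subset X$ is called equilateral if there is $p>0$ such that $\|x-y\|=p$ for all $x,y\in S$, $x\neq y$. The equilateral dimension $e(X)$ is the maximal cardinality of an equilateral set in $X$. A normed space $X=(\mathbb{R}^n,\|\cdot\|)$ is permutation-invariant if for every permutation $\sigma$ of $\{1,\dots,n\}$ and every $(x_1,\dots,x_n)\in\mathbb{R}^n$ we have $\|(x_1,x_2,\dots,x_n)\|=\|(x_{\sigma(1)},x_{\sigma(2)},\dots,x_{\sigma(n)})\|$. *)

theory Defs
  imports "HOL-Analysis.Analysis" "HOL-Combinatorics.Permutations"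
begin

text \<open>
  The norm of a space \<open>X = (\<real>\<^sup>n, \<parallel>\<cdot>\<parallel>)\<close> is an explicit function \<open>N\<close>, because the type class
  norm on \<open>real ^ 'n\<close> is the Euclidean one.
\<close>

definition is_norm :: "('a::real_vector \<Rightarrow> real) \<Rightarrow> bool" where
  "is_norm N \<longleftrightarrow>
     (\<forall>x. N x = 0 \<longleftrightarrow> x = 0) \<and>
     (\<forall>a x. N (a *\<^sub>R x) = \<bar>a\<bar> * N x) \<and>
     (\<forall>x y. N (x + y) \<le> N x + N y)"

definition permutation_invariant :: "(real ^ 'n::finite \<Rightarrow> real) \<Rightarrow> bool" where
  "permutation_invariant N \<longleftrightarrow>
     (\<forall>\<sigma>. \<sigma> permutes UNIV \<longrightarrow> (\<forall>x. N x = N (\<chi> i. x $ \<sigma> i)))"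

definition equilateral :: "('a::real_vector \<Rightarrow> real) \<Rightarrow> 'a set \<Rightarrow> bool" where
  "equilateral N S \<longleftrightarrow> (\<exists>p>0. \<forall>x\<in>S. \<forall>y\<in>S. x \<noteq> y \<longrightarrow> N (x - y) = p)"

text \<open>
  This is meaningful when equilateral sets are finite and of bounded cardinality; the two lemmas
  at the end show that this is so for every norm on a Euclidean space.
\<close>

definition equilateral_dim :: "('a::real_vector \<Rightarrow> real) \<Rightarrow> nat" where
  "equilateral_dim N = Max {card S | S. equilateral N S}"

lemma is_norm_minus_commute:
  assumes "is_norm N" shows "N (x - y) = N (y - x)"
proof -
  have "N ((-1) *\<^sub>R (x - y)) = \<bar>-1\<bar> * N (x - y)"
    using assms unfolding is_norm_def by blast
  then show ?thesis by simp
qed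

lemma is_norm_nonneg:
  assumes "is_norm N" shows "N x \<ge> 0"
proof -
  have "N (x - x) \<le> N x + N (0 - x)"
    using assms unfolding is_norm_def by (metis add.right_neutral diff_0 diff_conv_add_uminus)
  moreover have "N (0 - x) = N (x - 0)" by (rule is_norm_minus_commute[OF assms])
  moreover have "N 0 = 0" using assms unfolding is_norm_def by blast
  ultimately show ?thesis by simp
qed

lemma is_norm_upper_bound:
  fixes N :: "'a::euclidean_space \<Rightarrow> real"
  assumes "is_norm N"
  obtains C where "C > 0" "\<And>x. N x \<le> C * norm x"
proof -
  have tri: "N (x + y) \<le> N x + N y" and hom: "N (a *\<^sub>R x) = \<bar>a\<bar> * N x" and z: "N 0 = 0" for x y a
    using assms unfolding is_norm_def by blast+
  have sum_le: "N (sum f A) \<le> (\<Sum>a\<in>A. N (f a))" if "finite A" for f and A :: "'a set"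
    using that by (induction A rule: finite_induct) (auto simp: z intro: order_trans[OF tri])
  have "N x \<le> (1 + (\<Sum>b\<in>Basis. N b)) * norm x" for x
  proof -
    have "N x = N (\<Sum>b\<in>Basis. (x \<bullet> b) *\<^sub>R b)" by (simp add: euclidean_representation)
    also have "\<dots> \<le> (\<Sum>b\<in>Basis. \<bar>x \<bullet> b\<bar> * N b)"
      using sum_le[OF finite_Basis, of "\<lambda>b. (x \<bullet> b) *\<^sub>R b"] by (simp add: hom)
    also have "\<dots> \<le> (\<Sum>b\<in>Basis. norm x * N b)"
      by (intro sum_mono mult_right_mono Basis_le_norm is_norm_nonneg[OF assms]) auto
    also have "\<dots> \<le> (1 + (\<Sum>b\<in>Basis. N b)) * norm x"
      by (simp add: sum_distrib_left[symmetric] mult.commute[of _ "norm x"] distrib_left)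
    finally show ?thesis .
  qed
  moreover have "1 + (\<Sum>b\<in>Basis. N b) > 0"
    using sum_nonneg[of Basis N] is_norm_nonneg[OF assms] by (simp add: add_pos_nonneg)
  ultimately show ?thesis using that by blast
qed

lemma is_norm_continuous:
  fixes N :: "'a::euclidean_space \<Rightarrow> real"
  assumes "is_norm N" shows "continuous_on S N"
proof -
  obtain C where C: "C > 0" "\<And>x. N x \<le> C * norm x" using is_norm_upper_bound[OF assms] by blast
  have tri: "N (x + y) \<le> N x + N y" for x y
    using assms unfolding is_norm_def by blast
  have "\<bar>N x - N y\<bar> \<le> C * dist x y" for x y
    using tri[of "x - y" y] tri[of "y - x" x] is_norm_minus_commute[OF assms, of x y] C(2)[of "x - y"]
    by (simp add: dist_norm)
  then have "C-lipschitz_on S N"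
    using C(1) by (intro lipschitz_onI) (auto simp: dist_real_def)
  then show ?thesis by (rule lipschitz_on_continuous_on)
qed

lemma is_norm_lower_bound:
  fixes N :: "'a::euclidean_space \<Rightarrow> real"
  assumes "is_norm N"
  obtains m where "m > 0" "\<And>x. m * norm x \<le> N x"
proof -
  have hom: "N (a *\<^sub>R x) = \<bar>a\<bar> * N x" and z: "N x = 0 \<longleftrightarrow> x = 0" for x a
    using assms unfolding is_norm_def by blast+
  have "sphere (0::'a) 1 \<noteq> {}"
    using vector_choose_size[of 1] by fastforce
  then obtain u where u: "u \<in> sphere 0 1" "\<And>x. x \<in> sphere 0 1 \<Longrightarrow> N u \<le> N x"
    using continuous_attains_inf[OF compact_sphere _ is_norm_continuous[OF assms]] by metis
  have "u \<noteq> 0" using u(1) by auto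
  then have "N u > 0" using z[of u] is_norm_nonneg[OF assms, of u] by simp
  moreover have "N u * norm x \<le> N x" for x
  proof (cases "x = 0")
    case False
    then have "N u \<le> N ((1 / norm x) *\<^sub>R x)" by (intro u(2)) auto
    then show ?thesis using False by (simp add: hom field_simps)
  qed (simp add: is_norm_nonneg[OF assms])
  ultimately show ?thesis using that by blast
qed

lemma equilateral_bounded:
  fixes N :: "'a::euclidean_space \<Rightarrow> real"
  assumes "is_norm N"
  obtains k where "\<And>S. equilateral N S \<Longrightarrow> finite S \<and> card S \<le> k"
proof -
  have hom: "N (a *\<^sub>R x) = \<bar>a\<bar> * N x" and tri: "N (x + y) \<le> N x + N y" and z: "N 0 = 0" for x y a
    using assms unfolding is_norm_def by blast+
  obtain m where m: "m > 0" "\<And>x. m * norm x \<le> N x" using is_norm_lower_bound[OF assms] by blast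
  define K where "K = {x. N x \<le> 1}"
  define U where "U = (\<lambda>c. {x. N (x - c) < 1/2})"
  have "norm x \<le> 1 / m" if "x \<in> K" for x
    using m(1) m(2)[of x] that by (simp add: K_def field_simps)
  then have "bounded K" by (auto simp: bounded_iff)
  moreover have "closed K"
    unfolding K_def by (intro closed_Collect_le is_norm_continuous[OF assms] continuous_on_const)
  ultimately have "compact K" by (simp add: compact_eq_bounded_closed)
  moreover have "open (U c)" for c
    unfolding U_def
    by (intro open_Collect_less continuous_on_const
          continuous_on_compose2[OF is_norm_continuous[OF assms, of UNIV]] continuous_intros) auto
  moreover have "K \<subseteq> (\<Union>c\<in>K. U c)" by (auto simp: U_def z)
  ultimately obtain C where C: "C \<subseteq> K" "finite C" "K \<subseteq> (\<Union>c\<in>C. U c)"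
    using compactE_image[of K K U] by metis
  have "finite S \<and> card S \<le> card C" if "equilateral N S" for S
  proof (cases "S = {}")
    case False
    then obtain a where a: "a \<in> S" by blast
    obtain p where p: "p > 0" "\<And>x y. x \<in> S \<Longrightarrow> y \<in> S \<Longrightarrow> x \<noteq> y \<Longrightarrow> N (x - y) = p"
      using \<open>equilateral N S\<close> unfolding equilateral_def by blast
    define f where "f = (\<lambda>x. (1 / p) *\<^sub>R (x - a))"
    have "f x \<in> K" if "x \<in> S" for x
      using p(1) p(2)[OF that a] by (cases "x = a") (auto simp: f_def K_def hom z)
    then have "\<exists>c\<in>C. f x \<in> U c" if "x \<in> S" for x using C(3) that by blast
    then obtain g where g: "\<And>x. x \<in> S \<Longrightarrow> g x \<in> C \<and> f x \<in> U (g x)" by metis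
    have "inj_on g S"
    proof (rule inj_onI, rule ccontr)
      fix x y assume xy: "x \<in> S" "y \<in> S" "g x = g y" "x \<noteq> y"
      have "f x - f y = (1 / p) *\<^sub>R (x - y)" by (simp add: f_def algebra_simps)
      then have "N (f x - f y) = 1" using p(1) p(2)[OF xy(1,2,4)] by (simp add: hom)
      moreover have "N (f x - f y) \<le> N (f x - g x) + N (g x - f y)"
        using tri[of "f x - g x" "g x - f y"] by simp
      moreover have "N (f x - g x) < 1/2" "N (g x - f y) < 1/2"
        using g[OF xy(1)] g[OF xy(2)] xy(3) is_norm_minus_commute[OF assms, of "f y" "g x"]
        by (auto simp: U_def)
      ultimately show False by linarith
    qed
    then show ?thesis
      using C(2) g by (meson card_inj_on_le finite_imageD finite_subset image_subsetI)
  qed simp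
  then show ?thesis using that by blast
qed

lemma equilateral_finite:
  fixes N :: "'a::euclidean_space \<Rightarrow> real"
  assumes "is_norm N" "equilateral N S"
  shows "finite S"
  using equilateral_bounded[OF assms(1)] assms(2) by metis

lemma finite_card_equilateral:
  fixes N :: "'a::euclidean_space \<Rightarrow> real"
  assumes "is_norm N"
  shows "finite {card S | S. equilateral N S}"
proof -
  obtain k where "\<And>S. equilateral N S \<Longrightarrow> finite S \<and> card S \<le> k"
    using equilateral_bounded[OF assms] by blast
  then have "{card S | S. equilateral N S} \<subseteq> {..k}" by auto
  then show ?thesis by (rule finite_subset) simp
qed

end

theory Submission
  imports Defs
begin

text \<open>
  By symmetry the standard basis vectors are equilateral, at some distance \<open>p\<close>, and every point
  \<open>t (1, \<dots>, 1)\<close> of the diagonal is equidistant from all of them. At the centroid, \<open>t = 1/n\<close>, this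
  common distance is at most \<open>p\<close>, because \<open>e\<^sub>i\<close> minus the centroid is the average of the vectors
  \<open>e\<^sub>i - e\<^sub>j\<close>. It tends to infinity with \<open>t\<close>, so it equals \<open>p\<close> for some \<open>t\<close>.
\<close>

lemma is_norm_sum_le:
  assumes "is_norm N"
  shows "N (sum f A) \<le> (\<Sum>a\<in>A. N (f a))"
proof -
  have tri: "N (x + y) \<le> N x + N y" and z: "N 0 = 0" for x y
    using assms unfolding is_norm_def by blast+
  show ?thesis
    by (induction A rule: infinite_finite_induct) (auto simp: z intro: order_trans[OF tri])
qed

lemma card_le_equilateral_dim:
  fixes N :: "'a::euclidean_space \<Rightarrow> real"
  assumes "is_norm N" "equilateral N S"
  shows "card S \<le> equilateral_dim N"
  unfolding equilateral_dim_def
  using finite_card_equilateral[OF assms(1)] assms(2) by (intro Max_ge) auto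

lemma equilateral_insert_image:
  assumes N: "is_norm N" and "p > 0"
    and e: "\<And>i j. i \<in> I \<Longrightarrow> j \<in> I \<Longrightarrow> i \<noteq> j \<Longrightarrow> N (e i - e j) = p"
    and x: "\<And>i. i \<in> I \<Longrightarrow> N (e i - x) = p"
  shows "equilateral N (insert x (e ` I))"
  unfolding equilateral_def
proof (intro exI[of _ p] conjI ballI impI)
  fix y z assume "y \<in> insert x (e ` I)" "z \<in> insert x (e ` I)" "y \<noteq> z"
  then show "N (y - z) = p" using e x is_norm_minus_commute[OF N, of x] by fastforce
qed fact

text \<open>Intermediate value theorem along the line: the norm is at most \<open>p\<close> at
  parameter \<open>s\<close> and, being unbounded in the direction \<open>v\<close>, at least
  \<open>p\<close> further out.\<close>

lemma is_norm_attains_on_line: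
  fixes N :: "'a::euclidean_space \<Rightarrow> real"
  assumes N: "is_norm N" and "v \<noteq> 0" "N (x - s *\<^sub>R v) \<le> p"
  obtains t where "N (x - t *\<^sub>R v) = p"
proof -
  have tri: "N (x + y) \<le> N x + N y" and hom: "N (a *\<^sub>R x) = \<bar>a\<bar> * N x"
    and z: "N x = 0 \<longleftrightarrow> x = 0" for x y a
    using N unfolding is_norm_def by blast+
  have v: "N v > 0" using z[of v] is_norm_nonneg[OF N, of v] \<open>v \<noteq> 0\<close> by simp
  define w where "w = x - s *\<^sub>R v"
  \<comment> \<open>Chosen so that \<open>d * N v - N w = p\<close>; by the triangle inequality this
    difference bounds the norm at parameter \<open>s + d\<close> from below.\<close>
  define d where "d = (p + N w) / N v"
  have "p \<ge> 0" using assms(3) is_norm_nonneg[OF N] order_trans by blast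
  then have d: "d \<ge> 0" using v is_norm_nonneg[OF N, of w] by (simp add: d_def)
  have "d * N v = N (w - (x - (s + d) *\<^sub>R v))" using d by (simp add: w_def hom algebra_simps)
  also have "\<dots> \<le> N w + N (x - (s + d) *\<^sub>R v)"
    using tri[of w "(s + d) *\<^sub>R v - x"] is_norm_minus_commute[OF N, of x]
    by (metis diff_conv_add_uminus minus_diff_eq)
  finally have "p \<le> N (x - (s + d) *\<^sub>R v)" using v by (simp add: d_def)
  moreover have "continuous_on {s..s + d} (\<lambda>t. N (x - t *\<^sub>R v))"
    by (intro continuous_on_compose2[OF is_norm_continuous[OF N, of UNIV]] continuous_intros) auto
  ultimately show ?thesis
    using IVT'[of "\<lambda>t. N (x - t *\<^sub>R v)" s p "s + d"] assms(3) d that by (metis le_add_same_cancel1)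
qed

lemma permutation_invariant_transpose:
  assumes "permutation_invariant N"
  shows "N (\<chi> k. x $ Transposition.transpose a b k) = N x"
  using assms permutes_swap_id[OF UNIV_I UNIV_I] unfolding permutation_invariant_def by metis

text \<open>The transposition of \<open>i\<close> and \<open>k\<close> fixes \<open>j\<close>, so it
  carries one difference to the other.\<close>

lemma permutation_invariant_axis_diff_axis:
  assumes inv: "permutation_invariant N" and "i \<noteq> j" "k \<noteq> j"
  shows "N (axis i c - axis j c) = N (axis k c - axis j c)"
proof -
  have "(\<chi> l. (axis i c - axis j c) $ Transposition.transpose i k l) = axis k c - axis j c"
    using assms by (auto simp: vec_eq_iff axis_def Transposition.transpose_def)
  then show ?thesis using permutation_invariant_transpose[OF inv] by metis
qed

text \<open>Diagonal vectors are fixed by every permutation of the coordinates, so swapping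
  \<open>i\<close> and \<open>k\<close> moves only the axis vector.\<close>

lemma permutation_invariant_axis_diff_vec:
  assumes inv: "permutation_invariant N"
  shows "N (axis i c - vec t) = N (axis k c - vec t)"
proof -
  have "(\<chi> l. (axis i c - vec t) $ Transposition.transpose i k l) = axis k c - vec t"
    by (auto simp: vec_eq_iff axis_def Transposition.transpose_def)
  then show ?thesis using permutation_invariant_transpose[OF inv] by metis
qed

lemma permutation_invariant_axes_equilateral:
  fixes N :: "real ^ 'n::finite \<Rightarrow> real"
  assumes N: "is_norm N" and inv: "permutation_invariant N"
  obtains p where "p > 0" "\<And>i j. i \<noteq> j \<Longrightarrow> N (axis i 1 - axis j 1) = p"
proof (cases "\<exists>a b :: 'n. a \<noteq> b")
  case True
  then obtain a b :: 'n where ab: "a \<noteq> b" by blast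
  \<comment> \<open>The first index can be exchanged directly, the second one after reversing the
    difference; such moves lead from any pair of distinct indices to \<open>a\<close>,
    \<open>b\<close>.\<close>
  have "N (axis i 1 - axis j 1) = N (axis a 1 - axis b 1)" if "i \<noteq> j" for i j
    using that ab permutation_invariant_axis_diff_axis[OF inv, where c = 1]
      is_norm_minus_commute[OF N] by metis
  moreover have "axis a 1 - axis b 1 \<noteq> (0 :: real ^ 'n)" using ab by (simp add: axis_eq_axis)
  then have "N (axis a 1 - axis b 1) > 0"
    using N is_norm_nonneg[OF N, of "axis a 1 - axis b 1"] unfolding is_norm_def
    by (metis less_eq_real_def)
  ultimately show ?thesis using that by blast
next
  case False
  \<comment> \<open>With a single coordinate the condition on pairs is vacuous, and 1 is an
    arbitrary positive value.\<close>
  then show ?thesis using that[of 1] by fastforce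
qed

theorem theorem1p5:
  fixes N :: "real ^ 'n::finite \<Rightarrow> real"
  assumes "is_norm N"
    and "permutation_invariant N"
  shows "equilateral_dim N \<ge> CARD('n) + 1"
proof -
  have hom: "N (a *\<^sub>R x) = \<bar>a\<bar> * N x" and z: "N 0 = 0" for x a
    using assms unfolding is_norm_def by blast+
  define e :: "'n \<Rightarrow> real ^ 'n" where "e = (\<lambda>i. axis i 1)"
  obtain p where p: "p > 0" "\<And>i j. i \<noteq> j \<Longrightarrow> N (e i - e j) = p"
    using permutation_invariant_axes_equilateral[OF assms] unfolding e_def by metis
  define n where "n = real CARD('n)"
  have n: "n > 0" by (simp add: n_def)
  \<comment> \<open>One index suffices for finding \<open>t\<close>; invariance then transfers the
    distance to all the others.\<close>
  fix i :: 'n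
  \<comment> \<open>Here the vector \<open>1\<close> has all coordinates 1, and the average includes
    the zero term \<open>j = i\<close>.\<close>
  have "e i - (1 / n) *\<^sub>R 1 = (1 / n) *\<^sub>R (\<Sum>j\<in>UNIV. e i - e j)"
    using n by (auto simp: vec_eq_iff e_def axis_def of_nat_index n_def sum_subtractf field_simps)
  then have "N (e i - (1 / n) *\<^sub>R 1) = (1 / n) * N (\<Sum>j\<in>UNIV. e i - e j)"
    using n by (simp add: hom)
  also have "\<dots> \<le> (1 / n) * (\<Sum>j\<in>UNIV. N (e i - e j))"
    using n is_norm_sum_le[OF assms(1)] by (intro mult_left_mono) auto
  also have "\<dots> \<le> (1 / n) * (\<Sum>j\<in>(UNIV :: 'n set). p)"
    using n p z by (intro mult_left_mono sum_mono) (metis diff_self less_imp_le order_refl, simp)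
  also have "\<dots> = p" using n by (simp add: n_def)
  finally obtain t where t: "N (e i - t *\<^sub>R 1) = p"
    using is_norm_attains_on_line[OF assms(1) one_neq_zero] by metis
  define x :: "real ^ 'n" where "x = vec t"
  have "t *\<^sub>R 1 = x" by (simp add: x_def vec_eq_iff)
  then have x: "N (e j - x) = p" for j
    using t permutation_invariant_axis_diff_vec[OF assms(2)] unfolding e_def x_def by metis
  have "equilateral N (insert x (range e))"
    using p x by (intro equilateral_insert_image[OF assms(1), of p]) auto
  \<comment> \<open>Otherwise some distance \<open>N (e j - x)\<close> would be 0 instead of
    \<open>p\<close>.\<close>
  moreover have "x \<notin> range e" using x z p(1) by (metis diff_self imageE less_irrefl)
  moreover have "inj e" by (simp add: inj_def e_def axis_eq_axis)
  ultimately show ?thesis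
    using card_le_equilateral_dim[OF assms(1), of "insert x (range e)"] by (simp add: card_image)
qed

end
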